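(* Let $Q\in\mathcal{S}_o^n$ and $q<0$. If $K,L\in\mathcal{K}_o^n$, then $$\frac{1}{\widetilde{V}_q(K,Q)}\int_{S^{n-1}}\log\frac{h_L(v)}{h_K(v)}\,d\widetilde{C}_q(K,Q,v)\ge\frac1q\log\frac{\widetilde{V}_q(L,Q)}{\widetilde{V}_q(K,Q)},$$ with equality if and only if $K$ and $L$ are dilates.
   Context: $S^{n-1}$ is the unit sphere of $\mathbb{R}^n$ and $du$ is spherical Lebesgue measure. $\mathcal{K}_o^n$ is the set of convex bodies (compact convex sets with non-empty interior) in $\mathbb{R}^n$ containing the origin in their interiors. $\mathcal{S}_o^n$ is the set of star bodies (compact sets, star-shaped with respect to the origin, with continuous radial function) in $\mathbb{R}^n$ containing the origin in their interiors. The radial function is $\rho_Q(u)=\max\{\lambda\ge 0:\lambda u\in Q\}$, $u\in S^{n-1}$, and the support function is $h_K(v)=\max\{v\cdot x:x\in K\}$. $K$ and $L$ are dilates if $K=\lambda L$ for some $\lambda>0$. For $q\in\mathbb{R}$ and $K,Q\in\mathcal{S}_o^n$, the $q$-th dual mixed volume is $\widetilde{V}_q(K,Q)=\frac1n\int_{S^{n-1}}\rho_K^q(u)\rho_Q^{n-q}(u)\,du$. For $K\in\mathcal{K}_o^n$ and a Borel set $\eta\subseteq S^{n-1}$, $\boldsymbol{\alpha}^*_K(\eta)$ is the set of $u\in S^{n-1}$ such that some $v\in\eta$ is an outer unit normal of $K$ at $\rho_K(u)u$, i.e. $\rho_K(u)u\cdot v=h_K(v)$. The $q$-th dual curvature measure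 is the Borel measure $\widetilde{C}_q(K,Q,\eta)=\frac1n\int_{\boldsymbol{\alpha}^*_K(\eta)}\rho_K^q(u)\rho_Q^{n-q}(u)\,du$. *)

theory Defs
  imports "HOL-Analysis.Analysis"
begin

definition radial_fun :: "'a::euclidean_space set \<Rightarrow> 'a \<Rightarrow> real" where
  "radial_fun Q u = Sup {l. 0 \<le> l \<and> l *\<^sub>R u \<in> Q}"

definition support_fun :: "'a::euclidean_space set \<Rightarrow> 'a \<Rightarrow> real" where
  "support_fun K v = (SUP x\<in>K. v \<bullet> x)"

text \<open>For compact sets both suprema are maxima.\<close>

lemma radial_fun_is_max:
  fixes Q :: "'a::euclidean_space set"
  assumes Q: "compact Q" "0 \<in> Q" and u: "norm u = 1"
  shows "radial_fun Q u *\<^sub>R u \<in> Q" "0 \<le> radial_fun Q u"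
    and "\<And>l. 0 \<le> l \<Longrightarrow> l *\<^sub>R u \<in> Q \<Longrightarrow> l \<le> radial_fun Q u"
proof -
  let ?S = "{l. 0 \<le> l \<and> l *\<^sub>R u \<in> Q}"
  obtain B where B: "\<And>x. x \<in> Q \<Longrightarrow> norm x \<le> B"
    using Q(1) compact_imp_bounded bounded_iff by metis
  have bdd: "bdd_above ?S"
    by (rule bdd_aboveI[of _ B]) (use B u in force)
  have "closed ((\<lambda>l. l *\<^sub>R u) -` Q)"
    by (intro continuous_closed_vimage continuous_intros compact_imp_closed Q)
  moreover have "?S = {0..} \<inter> (\<lambda>l. l *\<^sub>R u) -` Q" by auto
  ultimately have "closed ?S" by (metis closed_Int closed_atLeast)
  moreover have "?S \<noteq> {}" using Q(2) by (auto intro!: exI[of _ 0])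
  ultimately have "Sup ?S \<in> ?S" using bdd by (intro closed_contains_Sup)
  then show "radial_fun Q u *\<^sub>R u \<in> Q" "0 \<le> radial_fun Q u"
    by (auto simp: radial_fun_def)
  show "l \<le> radial_fun Q u" if "0 \<le> l" "l *\<^sub>R u \<in> Q" for l
    unfolding radial_fun_def using bdd that by (intro cSup_upper) auto
qed

lemma support_fun_is_max:
  fixes K :: "'a::euclidean_space set"
  assumes "compact K" "K \<noteq> {}"
  shows "\<exists>x\<in>K. support_fun K v = v \<bullet> x" and "\<And>x. x \<in> K \<Longrightarrow> v \<bullet> x \<le> support_fun K v"
proof -
  have "compact ((\<lambda>x. v \<bullet> x) ` K)"
    by (intro compact_continuous_image continuous_intros assms)
  then have cl: "closed ((\<lambda>x. v \<bullet> x) ` K)" and bd: "bdd_above ((\<lambda>x. v \<bullet> x) ` K)"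
    by (auto intro: compact_imp_closed bounded_imp_bdd_above compact_imp_bounded)
  show "\<exists>x\<in>K. support_fun K v = v \<bullet> x"
    using closed_contains_Sup[OF _ bd cl] assms(2) by (auto simp: support_fun_def)
  show "v \<bullet> x \<le> support_fun K v" if "x \<in> K" for x
    unfolding support_fun_def using bd that by (intro cSUP_upper)
qed

definition convex_body_o :: "'a::euclidean_space set \<Rightarrow> bool" where
  "convex_body_o K \<longleftrightarrow> compact K \<and> convex K \<and> 0 \<in> interior K"

definition star_body_o :: "'a::euclidean_space set \<Rightarrow> bool" where
  "star_body_o Q \<longleftrightarrow> compact Q \<and> (\<forall>x\<in>Q. closed_segment 0 x \<subseteq> Q)
     \<and> continuous_on (sphere 0 1) (radial_fun Q) \<and> 0 \<in> interior Q"

definition dilates :: "'a::euclidean_space set \<Rightarrow> 'a set \<Rightarrow> bool" where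
  "dilates K L \<longleftrightarrow> (\<exists>c>0. K = (\<lambda>x. c *\<^sub>R x) ` L)"

text \<open>
  Spherical Lebesgue measure: on Borel sets it is the cone measure,
  i.e. dimension times the volume of the cone over the set, see \<open>emeasure_cone_measure\<close>.
  It is completed because \<open>reverse_radial_Gauss_image K E\<close> below need not be
  Borel for Borel \<open>E\<close>.
\<close>

definition cone_measure :: "'a::euclidean_space measure" where
  "cone_measure = distr (scale_measure (of_nat DIM('a)) (restrict_space lborel (ball 0 1 - {0})))
     (restrict_space borel (sphere 0 1)) (\<lambda>x. x /\<^sub>R norm x)"

definition sphere_lebesgue :: "'a::euclidean_space measure" where
  "sphere_lebesgue = completion cone_measure"

lemma emeasure_cone_measure:
  fixes A :: "'a::euclidean_space set"
  assumes A: "A \<in> sets borel" "A \<subseteq> sphere 0 1"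
  shows "emeasure cone_measure A
    = of_nat DIM('a) * emeasure lborel {r *\<^sub>R u | r u. 0 < r \<and> r < 1 \<and> u \<in> A}"
proof -
  let ?N = "restrict_space (lborel :: 'a measure) (ball 0 1 - {0})"
  let ?f = "\<lambda>x::'a. x /\<^sub>R norm x"
  have meas: "?f \<in> scale_measure (of_nat DIM('a)) ?N \<rightarrow>\<^sub>M restrict_space borel (sphere 0 1)"
  proof -
    have "?f \<in> ?N \<rightarrow>\<^sub>M restrict_space borel (sphere 0 1)"
      by (intro measurable_restrict_space2 measurable_restrict_space1)
         (auto simp: space_restrict_space)
    then show ?thesis
      using measurable_cong_sets[OF sets_scale_measure refl] by blast
  qed
  have sA: "A \<in> sets (restrict_space borel (sphere 0 1))"
    using A by (auto simp: sets_restrict_space_iff)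
  have eq: "?f -` A \<inter> space ?N = {r *\<^sub>R u | r u. 0 < r \<and> r < 1 \<and> u \<in> A}" (is "?L = ?R")
  proof (intro set_eqI iffI)
    fix x assume "x \<in> ?L"
    then have "x = norm x *\<^sub>R ?f x \<and> 0 < norm x \<and> norm x < 1 \<and> ?f x \<in> A"
      by (auto simp: space_restrict_space)
    then show "x \<in> ?R" by blast
  next
    fix x assume "x \<in> ?R"
    then obtain r u where "x = r *\<^sub>R u" "0 < r" "r < 1" "u \<in> A" by auto
    moreover then have "norm u = 1" using A by auto
    ultimately show "x \<in> ?L" by (auto simp: space_restrict_space)
  qed
  have "emeasure cone_measure A = of_nat DIM('a) * emeasure ?N (?f -` A \<inter> space ?N)"
    unfolding cone_measure_def by (subst emeasure_distr[OF meas sA]) (simp add: space_scale_measure)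
  also have "\<dots> = of_nat DIM('a) * emeasure lborel (?f -` A \<inter> space ?N)"
    by (subst emeasure_restrict_space) (auto simp: space_restrict_space)
  finally show ?thesis by (simp only: eq)
qed

definition dual_mixed_volume ::
    "real \<Rightarrow> 'a::euclidean_space set \<Rightarrow> 'a set \<Rightarrow> real" where
  "dual_mixed_volume q K Q = 1 / real DIM('a) *
     (LINT u|sphere_lebesgue. radial_fun K u powr q * radial_fun Q u powr (real DIM('a) - q))"

definition reverse_radial_Gauss_image :: "'a::euclidean_space set \<Rightarrow> 'a set \<Rightarrow> 'a set" where
  "reverse_radial_Gauss_image K E =
     {u \<in> sphere 0 1. \<exists>v\<in>E. (radial_fun K u *\<^sub>R u) \<bullet> v = support_fun K v}"

definition dual_curvature_measure ::
    "real \<Rightarrow> 'a::euclidean_space set \<Rightarrow> 'a set \<Rightarrow> 'a measure" where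
  "dual_curvature_measure q K Q =
     measure_of (sphere 0 1) (sets (restrict_space borel (sphere 0 1)))
       (\<lambda>E. ennreal (1 / real DIM('a)) *
         (\<integral>\<^sup>+u\<in>reverse_radial_Gauss_image K E.
            ennreal (radial_fun K u powr q * radial_fun Q u powr (real DIM('a) - q))
          \<partial>sphere_lebesgue))"

end

theory Submission
  imports Defs
begin

text \<open>
  Write \<open>\<mu>\<close> for spherical Lebesgue measure and \<open>w K = \<rho>\<^sub>K\<^sup>q \<rho>\<^sub>Q\<^sup>n\<^sup>-\<^sup>q\<close>. For \<open>\<mu>\<close>-almost every direction
  \<open>u\<close> the body \<open>K\<close> has exactly one outer unit normal \<open>\<alpha>(u)\<close> at \<open>\<rho>\<^sub>K(u) u\<close>, and the dual curvature
  measure is the image of \<open>w K \<mu> / n\<close> under \<open>\<alpha>\<close> (\<open>dual_curvature_measure_eq_distr\<close>). The left hand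
  side of the inequality is therefore an average over \<open>u\<close>, with weight \<open>w K\<close>, of
  \<open>log (h\<^sub>L(\<alpha>(u)) / h\<^sub>K(\<alpha>(u)))\<close>. Here \<open>h\<^sub>K(\<alpha>(u)) = \<rho>\<^sub>K(u) u \<bullet> \<alpha>(u)\<close>, while
  \<open>h\<^sub>L(\<alpha>(u)) \<ge> \<rho>\<^sub>L(u) u \<bullet> \<alpha>(u)\<close> because \<open>\<rho>\<^sub>L(u) u\<close> lies in \<open>L\<close>; so the integrand is at least
  \<open>log (\<rho>\<^sub>L(u) / \<rho>\<^sub>K(u)) = (1/q) log (w L / w K)\<close> (\<open>radial_ratio_le_support_ratio\<close>). By concavity of the
  logarithm the average of \<open>log (w L / w K)\<close> is at most the logarithm of the average
  \<open>V\<^sub>q(L,Q) / V\<^sub>q(K,Q)\<close>, and division by \<open>q < 0\<close> reverses this to the claim. Equality in the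
  concavity step forces \<open>\<rho>\<^sub>L / \<rho>\<^sub>K\<close> to be constant almost everywhere, hence everywhere by
  continuity, which says that the bodies are dilates (\<open>dual_log_Minkowski\<close>).

  The delicate point is the uniqueness of outer normals almost everywhere, on which the additivity
  of the dual curvature measure rests. It is obtained by duality.
  The vectors \<open>v / h\<^sub>K(v)\<close>, for unit \<open>v\<close>, form a compact set \<open>P\<close> with \<open>1 / \<rho>\<^sub>K(u) = max\<^sub>p\<^sub>\<in>\<^sub>P u \<bullet> p\<close>,
  and \<open>v\<close> is normal to \<open>K\<close> at \<open>\<rho>\<^sub>K(u) u\<close> exactly when \<open>v / h\<^sub>K(v)\<close> attains this maximum. For any
  compact \<open>P\<close> the maximizer is unique for almost every \<open>u\<close>
  (\<open>null_sets_nonunique_maximizer\<close>): along a line with direction \<open>e\<close> the \<open>e\<close>-components of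
  maximizers increase, so they are ambiguous at countably many points only, and Tonelli's theorem
  turns this into a null set.
\<close>

section \<open>Points with several maximizers of a linear functional\<close>

text \<open>
  For convex \<open>P\<close> this is the exposed face of \<open>P\<close> in direction \<open>x\<close>; equivalently, it consists of
  those subgradients of the convex function \<open>support_fun P\<close> at \<open>x\<close> that lie in \<open>P\<close>. Uniqueness
  of the maximizer is thus differentiability of the support function.
\<close>

definition exposed_face :: "'a::euclidean_space set \<Rightarrow> 'a \<Rightarrow> 'a set" where
  "exposed_face P x = {p \<in> P. x \<bullet> p = support_fun P x}"

lemma exposed_face_nonempty:
  assumes "compact P" "P \<noteq> {}"
  shows "exposed_face P x \<noteq> {}"
  using support_fun_is_max(1)[OF assms, of x] by (auto simp: exposed_face_def)

text \<open>
  Monotonicity of the subgradients of a convex function, restricted to a line: add the two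
  inequalities that express the maximality of \<open>p\<close> and of \<open>p'\<close>.
\<close>

lemma exposed_face_monotone:
  assumes P: "compact P" and p: "p \<in> exposed_face P (x + s *\<^sub>R e)" and p': "p' \<in> exposed_face P (x + t *\<^sub>R e)"
    and st: "s < t"
  shows "e \<bullet> p \<le> e \<bullet> p'"
proof -
  have ne: "P \<noteq> {}" and in_P: "p \<in> P" "p' \<in> P" using p p' by (auto simp: exposed_face_def)
  have "(x + s *\<^sub>R e) \<bullet> p' \<le> (x + s *\<^sub>R e) \<bullet> p" "(x + t *\<^sub>R e) \<bullet> p \<le> (x + t *\<^sub>R e) \<bullet> p'"
    using support_fun_is_max(2)[OF P ne] in_P p p' by (auto simp: exposed_face_def)
  then have "0 \<le> (t - s) * (e \<bullet> p' - e \<bullet> p)"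
    by (simp add: algebra_simps inner_add_left)
  then show ?thesis using st by (simp add: zero_le_mult_iff)
qed

lemma exposed_face_cone:
  assumes P: "compact P" and r: "0 < r" and p: "p \<in> exposed_face P x"
  shows "p \<in> exposed_face P (r *\<^sub>R x)"
proof -
  have ne: "P \<noteq> {}" and pP: "p \<in> P" using p by (auto simp: exposed_face_def)
  obtain z where z: "z \<in> P" "support_fun P (r *\<^sub>R x) = r *\<^sub>R x \<bullet> z"
    using support_fun_is_max(1)[OF P ne] by blast
  have "x \<bullet> z \<le> x \<bullet> p"
    using support_fun_is_max(2)[OF P ne z(1)] p by (auto simp: exposed_face_def)
  then have "support_fun P (r *\<^sub>R x) \<le> r *\<^sub>R x \<bullet> p"
    using z(2) r by simp
  moreover have "r *\<^sub>R x \<bullet> p \<le> support_fun P (r *\<^sub>R x)"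
    by (rule support_fun_is_max(2)[OF P ne pP])
  ultimately show ?thesis using pP by (simp add: exposed_face_def)
qed

text \<open>
  Select one maximizer at each point of the line. The \<open>e\<close>-component of the selection is a monotone
  function, so it has only countably many discontinuities; at a point of continuity monotonicity
  squeezes the \<open>e\<close>-component of every maximizer between the two one-sided limits.
\<close>

lemma countable_nonunique_maximizer_on_line:
  assumes P: "compact P" "P \<noteq> {}"
  shows "countable {t. \<exists>p\<in>exposed_face P (x + t *\<^sub>R e). \<exists>p'\<in>exposed_face P (x + t *\<^sub>R e). e \<bullet> p \<noteq> e \<bullet> p'}"
    (is "countable ?A")
proof -
  define p where "p t = (SOME p. p \<in> exposed_face P (x + t *\<^sub>R e))" for t
  have p: "p t \<in> exposed_face P (x + t *\<^sub>R e)" for t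
    unfolding p_def by (rule someI_ex) (use exposed_face_nonempty[OF P] in blast)
  define c where "c t = e \<bullet> p t" for t
  have "mono c"
    using exposed_face_monotone[OF P(1) p p] by (auto simp: mono_def c_def le_less)
  then have "countable {t. \<not> isCont c t}" by (rule mono_ctble_discont)
  moreover have "?A \<subseteq> {t. \<not> isCont c t}"
  proof (rule subsetI, rule CollectI, rule notI)
    fix t assume t: "t \<in> ?A" and cont: "isCont c t"
    have "e \<bullet> r = c t" if r: "r \<in> exposed_face P (x + t *\<^sub>R e)" for r
    proof (rule antisym)
      have "(c \<longlongrightarrow> c t) (at_right t)" "(c \<longlongrightarrow> c t) (at_left t)"
        using cont by (auto simp: isCont_def filterlim_at_split)
      moreover have "\<forall>\<^sub>F s in at_right t. e \<bullet> r \<le> c s"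
        by (rule eventually_at_right_less[THEN eventually_mono])
           (use exposed_face_monotone[OF P(1) r p] in \<open>auto simp: c_def\<close>)
      moreover have "\<forall>\<^sub>F s in at_left t. c s \<le> e \<bullet> r"
        by (rule eventually_at_left_real[of "t - 1", THEN eventually_mono])
           (use exposed_face_monotone[OF P(1) p r] in \<open>auto simp: c_def\<close>)
      ultimately show "e \<bullet> r \<le> c t" "c t \<le> e \<bullet> r"
        by (auto intro: tendsto_lowerbound tendsto_upperbound)
    qed
    with t show False by auto
  qed
  ultimately show ?thesis by (rule countable_subset[rotated])
qed

text \<open>
  A pointwise maximum of linear functions is convex, and finite convex functions are continuous.
\<close>

lemma continuous_on_support_fun:
  assumes P: "compact P" "P \<noteq> {}"
  shows "continuous_on S (support_fun P)"
proof -
  have "convex_on UNIV (support_fun P)"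
  proof (rule convex_onI)
    fix t :: real and x y :: 'a assume t: "0 < t" "t < 1"
    obtain p where p: "p \<in> P" "support_fun P ((1 - t) *\<^sub>R x + t *\<^sub>R y) = ((1 - t) *\<^sub>R x + t *\<^sub>R y) \<bullet> p"
      using support_fun_is_max(1)[OF P] by blast
    show "support_fun P ((1 - t) *\<^sub>R x + t *\<^sub>R y) \<le> (1 - t) * support_fun P x + t * support_fun P y"
      unfolding p(2) inner_add_left inner_scaleR_left
      by (intro add_mono mult_left_mono support_fun_is_max(2)[OF P p(1)]) (use t in auto)
  qed simp
  then show ?thesis
    using convex_on_continuous[OF open_UNIV] continuous_on_subset by blast
qed

text \<open>
  The set is \<open>F\<^sub>\<sigma>\<close>: asking for a gap of size at least \<open>1/(n+1)\<close> makes it the projection, along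
  the compact set \<open>P \<times> P\<close>, of a closed set.
\<close>

lemma borel_nonunique_maximizer:
  assumes P: "compact P" "P \<noteq> {}"
  shows "{x. \<exists>p\<in>exposed_face P x. \<exists>p'\<in>exposed_face P x. e \<bullet> p \<noteq> e \<bullet> p'} \<in> sets borel" (is "?A \<in> _")
proof -
  define C where "C n = {x. \<exists>z. z \<in> P \<times> P \<and> (z, x) \<in> {((p, p'), x). x \<bullet> p = support_fun P x
      \<and> x \<bullet> p' = support_fun P x \<and> e \<bullet> p' + inverse (real (Suc n)) \<le> e \<bullet> p}}" for n
  have "closed (C n)" for n
    unfolding C_def
  proof (rule closed_compact_projection)
    show "compact (P \<times> P)" using P by (intro compact_Times)
    have [continuous_intros]: "continuous_on UNIV (\<lambda>z::('a \<times> 'a) \<times> 'a. support_fun P (snd z))"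
      by (intro continuous_on_compose2[OF continuous_on_support_fun[OF P, of UNIV]] continuous_intros) auto
    show "closed {((p, p'), x). x \<bullet> p = support_fun P x
      \<and> x \<bullet> p' = support_fun P x \<and> e \<bullet> p' + inverse (real (Suc n)) \<le> e \<bullet> p}"
      unfolding case_prod_unfold
      by (intro closed_Collect_conj closed_Collect_eq closed_Collect_le continuous_intros)
  qed
  moreover have "?A = (\<Union>n. C n)"
  proof (intro set_eqI iffI)
    fix x assume "x \<in> ?A"
    then obtain p p' where pp: "p \<in> exposed_face P x" "p' \<in> exposed_face P x" "e \<bullet> p' < e \<bullet> p"
      by (force simp: neq_iff)
    then obtain n where "inverse (real (Suc n)) < e \<bullet> p - e \<bullet> p'"
      using reals_Archimedean[of "e \<bullet> p - e \<bullet> p'"] by auto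
    with pp have "x \<in> C n"
      unfolding C_def exposed_face_def by (intro CollectI exI[of _ "(p, p')"]) auto
    then show "x \<in> (\<Union>n. C n)" by blast
  next
    fix x assume "x \<in> (\<Union>n. C n)"
    then obtain n p p' where *: "p \<in> exposed_face P x" "p' \<in> exposed_face P x" "e \<bullet> p' + inverse (real (Suc n)) \<le> e \<bullet> p"
      unfolding C_def exposed_face_def by auto
    have "inverse (real (Suc n)) > 0" by simp
    with *(3) have "e \<bullet> p \<noteq> e \<bullet> p'" by linarith
    with * show "x \<in> ?A" by blast
  qed
  ultimately show ?thesis by (auto intro: borel_closed)
qed

text \<open>
  Integrate the indicator of \<open>A\<close> at \<open>x + t e\<close> over all \<open>x\<close> and over \<open>0 \<le> t \<le> 1\<close>. Integrating over
  \<open>t\<close> first gives zero; integrating over \<open>x\<close> first gives the measure of \<open>A\<close>, by translation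
  invariance.
\<close>

lemma null_if_countable_on_parallel_lines:
  fixes A :: "'a::euclidean_space set"
  assumes A: "A \<in> sets borel" and count: "\<And>x. countable {t. x + t *\<^sub>R e \<in> A}"
  shows "A \<in> null_sets lborel"
proof -
  have [measurable]: "A \<in> sets borel" by (fact A)
  have "(\<integral>\<^sup>+t. \<integral>\<^sup>+x. indicator {0..1} t * indicator A (x + t *\<^sub>R e) \<partial>lborel \<partial>(lborel :: real measure))
      = (\<integral>\<^sup>+x. \<integral>\<^sup>+t. indicator {0..1} t * indicator A (x + t *\<^sub>R e) \<partial>lborel \<partial>lborel)"
    by (rule lborel_pair.Fubini') measurable
  also have "\<dots> = (\<integral>\<^sup>+x. 0 \<partial>(lborel :: 'a measure))"
  proof (rule nn_integral_cong)
    fix x :: 'a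
    have "AE t in lborel. t \<notin> {t. x + t *\<^sub>R e \<in> A}"
      by (intro AE_not_in countable_imp_null_set_lborel count)
    then have "AE t in lborel. indicator {0..1::real} t * indicator A (x + t *\<^sub>R e) = (0::ennreal)"
      by eventually_elim auto
    then show "(\<integral>\<^sup>+t. indicator {0..1} t * indicator A (x + t *\<^sub>R e) \<partial>(lborel::real measure)) = 0"
      by (subst nn_integral_cong_AE[where v = "\<lambda>_. 0"]) auto
  qed
  also have "\<dots> = 0" by simp
  finally have zero: "(\<integral>\<^sup>+t. \<integral>\<^sup>+x. indicator {0..1} t * indicator A (x + t *\<^sub>R e) \<partial>lborel \<partial>(lborel :: real measure)) = 0" .
  have "(\<integral>\<^sup>+x. indicator A (x + t *\<^sub>R e) \<partial>lborel) = emeasure lborel A" for t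
  proof -
    have "emeasure lborel A = (\<integral>\<^sup>+x. indicator A x \<partial>distr lborel borel ((+) (t *\<^sub>R e)))"
      by (simp add: lborel_distr_plus)
    also have "\<dots> = (\<integral>\<^sup>+x. indicator A (x + t *\<^sub>R e) \<partial>lborel)"
      by (subst nn_integral_distr) (auto simp: add.commute)
    finally show ?thesis by simp
  qed
  then have "(\<integral>\<^sup>+x. indicator {0..1} t * indicator A (x + t *\<^sub>R e) \<partial>lborel) = indicator {0..1} t * emeasure lborel A" for t :: real
    by (subst nn_integral_cmult) auto
  with zero have "emeasure lborel A = 0"
    by (simp add: nn_integral_multc)
  then show ?thesis by auto
qed

lemma null_sets_nonunique_maximizer:
  assumes P: "compact P" "P \<noteq> {}"
  shows "{x. \<exists>p\<in>exposed_face P x. \<exists>p'\<in>exposed_face P x. p \<noteq> p'} \<in> null_sets lborel" (is "?A \<in> _")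
proof -
  \<comment> \<open>Two different maximizers differ in some coordinate direction.\<close>
  have neq: "p \<noteq> p' \<longleftrightarrow> (\<exists>e\<in>Basis. e \<bullet> p \<noteq> e \<bullet> p')" for p p' :: 'a
    by (metis euclidean_eq_iff inner_commute)
  have "?A = (\<Union>e\<in>Basis. {x. \<exists>p\<in>exposed_face P x. \<exists>p'\<in>exposed_face P x. e \<bullet> p \<noteq> e \<bullet> p'})"
    unfolding neq by blast
  also have "\<dots> \<in> null_sets lborel"
  proof (rule null_sets_UN')
    show "countable (Basis :: 'a set)" by (simp add: countable_finite)
    show "{x. \<exists>p\<in>exposed_face P x. \<exists>p'\<in>exposed_face P x. e \<bullet> p \<noteq> e \<bullet> p'} \<in> null_sets lborel" for e :: 'a
      by (rule null_if_countable_on_parallel_lines[OF borel_nonunique_maximizer[OF P], of e])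
         (use countable_nonunique_maximizer_on_line[OF P, of _ e] in auto)
  qed
  finally show ?thesis .
qed

section \<open>Spherical Lebesgue measure\<close>

lemma space_sphere_lebesgue [simp]: "space sphere_lebesgue = sphere 0 1"
  by (simp add: sphere_lebesgue_def cone_measure_def space_restrict_space)

lemma sets_cone_measure [measurable_cong, simp]:
  "sets cone_measure = sets (restrict_space borel (sphere 0 1))"
  by (simp add: cone_measure_def)

lemma sets_sphere_lebesgue:
  assumes "A \<in> sets borel" "A \<subseteq> sphere 0 1"
  shows "A \<in> sets sphere_lebesgue"
  using assms by (auto simp: sphere_lebesgue_def sets_restrict_space_iff intro!: sets_completionI_sets)

lemma finite_measure_sphere_lebesgue: "finite_measure (sphere_lebesgue :: 'a::euclidean_space measure)"
proof (rule finite_measureI)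
  have "{r *\<^sub>R u | r u. 0 < r \<and> r < 1 \<and> u \<in> sphere 0 1} \<subseteq> (ball 0 1 :: 'a set)"
    by auto
  then have "emeasure lborel {r *\<^sub>R u | r u. 0 < r \<and> r < 1 \<and> u \<in> (sphere 0 1 :: 'a set)} \<le> emeasure lborel (ball 0 1 :: 'a set)"
    by (intro emeasure_mono) auto
  also have "\<dots> < \<infinity>" by (rule emeasure_lborel_ball_finite)
  finally have "emeasure cone_measure (sphere 0 1 :: 'a set) < \<infinity>"
    by (subst emeasure_cone_measure) (auto simp: ennreal_mult_less_top of_nat_less_top)
  then show "emeasure sphere_lebesgue (space sphere_lebesgue :: 'a set) \<noteq> \<infinity>"
    unfolding space_sphere_lebesgue
    by (simp add: sphere_lebesgue_def sets_restrict_space_iff)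
qed

text \<open>
  The spherical measure of a set is, up to the factor \<open>n\<close>, the volume of the part of the cone
  over it inside the unit ball, so Lebesgue null cones cut the sphere in null sets.
\<close>

lemma AE_sphere_not_in_null_cone:
  assumes A: "A \<in> null_sets lborel" and cone: "\<And>r x. 0 < r \<Longrightarrow> x \<in> A \<Longrightarrow> r *\<^sub>R x \<in> A"
  shows "AE u in sphere_lebesgue. u \<notin> A"
proof -
  have A_borel: "A \<in> sets borel" using A by auto
  have "emeasure lborel {r *\<^sub>R u | r u. 0 < r \<and> r < 1 \<and> u \<in> A \<inter> sphere 0 1} \<le> emeasure lborel A"
    using A by (intro emeasure_mono) (auto intro: cone)
  also have "\<dots> = 0" using A by auto
  finally have "emeasure cone_measure (A \<inter> sphere 0 1) = 0"
    by (subst emeasure_cone_measure) (auto simp: A_borel)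
  then have "A \<inter> sphere 0 1 \<in> null_sets cone_measure"
    by (auto simp: null_sets_def sets_restrict_space_iff A_borel)
  then have "AE u in sphere_lebesgue. u \<notin> A \<inter> sphere 0 1"
    unfolding sphere_lebesgue_def by (intro AE_completion AE_not_in)
  with AE_space show ?thesis by eventually_elim auto
qed

lemma borel_measurable_sphere_lebesgue:
  fixes f :: "'a::euclidean_space \<Rightarrow> real"
  assumes "continuous_on (sphere 0 1) f"
  shows "f \<in> borel_measurable sphere_lebesgue"
  unfolding sphere_lebesgue_def
  by (intro measurable_completion)
     (use borel_measurable_continuous_on_restrict[OF assms] measurable_cong_sets[OF sets_cone_measure refl] in blast)

lemma integrable_sphere_lebesgue:
  fixes f :: "'a::euclidean_space \<Rightarrow> real"
  assumes f: "continuous_on (sphere 0 1) f"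
  shows "integrable sphere_lebesgue f"
proof -
  interpret finite_measure "sphere_lebesgue :: 'a measure" by (rule finite_measure_sphere_lebesgue)
  have "compact (f ` sphere 0 1)" using f by (intro compact_continuous_image) auto
  then obtain B where "\<And>u. u \<in> sphere 0 1 \<Longrightarrow> \<bar>f u\<bar> \<le> B"
    using compact_imp_bounded bounded_iff by (metis imageI real_norm_def)
  then show ?thesis
    by (intro integrable_const_bound[of _ B] borel_measurable_sphere_lebesgue f AE_I2) auto
qed

text \<open>
  Relatively open nonempty subsets of the sphere have positive measure, since the cone over such
  a set contains a ball.
\<close>

lemma AE_zero_imp_zero_on_sphere:
  fixes f :: "'a::euclidean_space \<Rightarrow> real"
  assumes f: "continuous_on (sphere 0 1) f" and ae: "AE u in sphere_lebesgue. f u = 0"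
    and u: "u \<in> sphere 0 1"
  shows "f u = 0"
proof (rule ccontr)
  assume fu: "f u \<noteq> 0"
  define A where "A = {u \<in> sphere 0 1. f u \<noteq> 0}"
  have "openin (top_of_set (sphere 0 1)) (sphere 0 1 \<inter> f -` (- {0}))"
    using f by (intro continuous_openin_preimage_gen) auto
  also have "sphere 0 1 \<inter> f -` (- {0}) = A" by (auto simp: A_def)
  finally obtain T where T: "open T" "A = sphere 0 1 \<inter> T"
    by (auto simp: openin_open)
  then have A_borel: "A \<in> sets borel" by auto
  have "AE v in cone_measure. f v = 0"
    using ae unfolding sphere_lebesgue_def AE_completion_iff .
  moreover have "A = {v \<in> space cone_measure. \<not> f v = 0}"
    by (simp add: A_def cone_measure_def space_restrict_space)
  ultimately have "emeasure cone_measure A = 0"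
    using A_borel by (subst (asm) AE_iff_measurable) (auto simp: sets_restrict_space_iff A_def)
  then have null: "emeasure lborel {r *\<^sub>R v | r v. 0 < r \<and> r < 1 \<and> v \<in> A} = 0"
    using A_borel by (subst (asm) emeasure_cone_measure) (auto simp: A_def)
  have eq: "{r *\<^sub>R v | r v. 0 < r \<and> r < 1 \<and> v \<in> A} = (ball 0 1 - {0}) \<inter> (\<lambda>x. x /\<^sub>R norm x) -` T"
    (is "?C = ?C'")
  proof (intro set_eqI iffI)
    fix x assume "x \<in> ?C'"
    then have "x = norm x *\<^sub>R (x /\<^sub>R norm x)" "0 < norm x" "norm x < 1" "x /\<^sub>R norm x \<in> A"
      using T(2) by auto
    then show "x \<in> ?C" by blast
  qed (use T(2) in auto)
  have op: "open ?C"
    unfolding eq by (intro continuous_open_preimage continuous_intros T) auto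
  have "(1/2) *\<^sub>R u \<in> ?C"
    using u fu by (auto simp: A_def intro!: exI[of _ "1/2"])
  then obtain e where e: "0 < e" "ball ((1/2) *\<^sub>R u) e \<subseteq> ?C"
    using op open_contains_ball by blast
  have "emeasure lborel (ball ((1/2) *\<^sub>R u) e) \<le> emeasure lborel ?C"
    using e(2) op by (intro emeasure_mono) auto
  then have "measure lborel (ball ((1/2) *\<^sub>R u) e) = 0"
    using null by (simp add: measure_def)
  with content_ball_pos[OF e(1), of "(1/2) *\<^sub>R u"] show False by simp
qed

section \<open>The almost everywhere defined Gauss map\<close>

lemma AE_sphere_unique_maximizer:
  assumes P: "compact P" "P \<noteq> {}"
  shows "AE u in sphere_lebesgue. \<forall>p\<in>exposed_face P u. \<forall>p'\<in>exposed_face P u. p = p'"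
proof -
  have "AE u in sphere_lebesgue. u \<notin> {x. \<exists>p\<in>exposed_face P x. \<exists>p'\<in>exposed_face P x. p \<noteq> p'}"
    by (rule AE_sphere_not_in_null_cone[OF null_sets_nonunique_maximizer[OF P]]) (use exposed_face_cone[OF P(1)] in blast)
  then show ?thesis by eventually_elim auto
qed

lemma convex_body_oD:
  assumes "convex_body_o K"
  shows "compact K" "convex K" "0 \<in> K" "K \<noteq> {}" "0 \<in> interior K"
  using assms interior_subset by (auto simp: convex_body_o_def)

lemma radial_fun_pos:
  fixes Q :: "'a::euclidean_space set"
  assumes Q: "compact Q" "0 \<in> interior Q" and u: "u \<in> sphere 0 1"
  shows "0 < radial_fun Q u"
proof -
  obtain e where e: "0 < e" "ball 0 e \<subseteq> Q" using Q(2) mem_interior by blast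
  have "(e / 2) *\<^sub>R u \<in> Q" using e u by (intro subsetD[OF e(2)]) auto
  moreover have "0 \<in> Q" using Q(2) interior_subset by blast
  ultimately have "e / 2 \<le> radial_fun Q u"
    by (intro radial_fun_is_max(3)[OF Q(1)]) (use e(1) u in auto)
  then show ?thesis using e(1) by simp
qed

lemma support_fun_pos:
  assumes K: "convex_body_o K" and v: "v \<in> sphere 0 1"
  shows "0 < support_fun K v"
proof -
  note Kb = convex_body_oD[OF K]
  have "0 < radial_fun K v" using radial_fun_pos Kb v by blast
  also have "radial_fun K v = v \<bullet> (radial_fun K v *\<^sub>R v)"
    using v by (simp add: dot_square_norm)
  also have "\<dots> \<le> support_fun K v"
    using support_fun_is_max(2) radial_fun_is_max(1) Kb v by (metis mem_sphere_0)
  finally show ?thesis .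
qed

text \<open>
  This is the boundary of the polar body \<open>{p. \<forall>x\<in>K. x \<bullet> p \<le> 1}\<close>, parametrized by the outer unit
  normals of \<open>K\<close>. Its support function is the gauge (Minkowski functional) of \<open>K\<close>.
\<close>

definition polar_boundary :: "'a::euclidean_space set \<Rightarrow> 'a set" where
  "polar_boundary K = (\<lambda>v. v /\<^sub>R support_fun K v) ` sphere 0 1"

lemma compact_polar_boundary:
  assumes K: "convex_body_o K"
  shows "compact (polar_boundary K)" "polar_boundary K \<noteq> {}"
proof -
  show "compact (polar_boundary K)"
    unfolding polar_boundary_def
    using support_fun_pos[OF K] convex_body_oD[OF K]
    by (intro compact_continuous_image continuous_intros continuous_on_support_fun) force+
  show "polar_boundary K \<noteq> {}"
    by (simp add: polar_boundary_def)
qed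

lemma inner_le_support_times_polar:
  assumes K: "convex_body_o K" and v: "v \<in> sphere 0 1"
  shows "u \<bullet> v \<le> support_fun K v * support_fun (polar_boundary K) u"
proof -
  have "u \<bullet> (v /\<^sub>R support_fun K v) \<le> support_fun (polar_boundary K) u"
    by (rule support_fun_is_max(2)[OF compact_polar_boundary[OF K]]) (use v in \<open>auto simp: polar_boundary_def\<close>)
  then show ?thesis
    using support_fun_pos[OF K v] by (simp add: field_simps)
qed

lemma inner_eq_support_times_polar:
  assumes K: "convex_body_o K"
  obtains v where "v \<in> sphere 0 1" "u \<bullet> v = support_fun K v * support_fun (polar_boundary K) u"
proof -
  obtain v where v: "v \<in> sphere 0 1" "support_fun (polar_boundary K) u = u \<bullet> (v /\<^sub>R support_fun K v)"
    using support_fun_is_max(1)[OF compact_polar_boundary[OF K], of u] by (auto simp: polar_boundary_def)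
  then show thesis
    using that[OF v(1)] support_fun_pos[OF K v(1)] by (simp add: field_simps)
qed

text \<open>
  A closed convex set is the intersection of its supporting half-spaces.
\<close>

lemma mem_if_below_support_fun:
  assumes K: "convex_body_o K" and z: "\<And>v. v \<in> sphere 0 1 \<Longrightarrow> v \<bullet> z \<le> support_fun K v"
  shows "z \<in> K"
proof (rule ccontr)
  assume "z \<notin> K"
  note Kb = convex_body_oD[OF K]
  obtain a b where ab: "a \<bullet> z < b" "\<And>x. x \<in> K \<Longrightarrow> a \<bullet> x > b"
    using separating_hyperplane_closed_point[OF Kb(2) compact_imp_closed[OF Kb(1)] \<open>z \<notin> K\<close>] by blast
  have "a \<noteq> 0" using ab ab(2)[OF Kb(3)] by auto
  define v where "v = (- inverse (norm a)) *\<^sub>R a"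
  have v: "v \<in> sphere 0 1" using \<open>a \<noteq> 0\<close> by (simp add: v_def)
  obtain x where x: "x \<in> K" "support_fun K v = v \<bullet> x"
    using support_fun_is_max(1)[OF Kb(1,4)] by blast
  have "a \<bullet> z < a \<bullet> x" using ab(1) ab(2)[OF x(1)] by linarith
  then have "v \<bullet> x < v \<bullet> z" using \<open>a \<noteq> 0\<close> by (simp add: v_def)
  with z[OF v] x(2) show False by simp
qed

text \<open>
  Duality between the radial function of \<open>K\<close> and the support function of its polar. One inequality
  holds because the point \<open>\<rho>\<^sub>K(u) u\<close> of \<open>K\<close> satisfies every support inequality of \<open>K\<close>, the other
  because \<open>u / h\<close>, with \<open>h\<close> the polar support function at \<open>u\<close>, satisfies all of them too and
  therefore belongs to \<open>K\<close>.
\<close>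

lemma radial_fun_times_polar_support:
  assumes K: "convex_body_o K" and u: "u \<in> sphere 0 1"
  shows "radial_fun K u * support_fun (polar_boundary K) u = 1"
proof -
  note Kb = convex_body_oD[OF K]
  have nu: "norm u = 1" using u by simp
  let ?r = "radial_fun K u" and ?h = "support_fun (polar_boundary K) u"
  have "0 < 1 / support_fun K u" using support_fun_pos[OF K u] by simp
  also have "\<dots> \<le> ?h"
    using inner_le_support_times_polar[OF K u, of u] support_fun_pos[OF K u] nu
    by (simp add: dot_square_norm field_simps)
  finally have h: "0 < ?h" .
  have "inverse ?h *\<^sub>R u \<in> K"
  proof (rule mem_if_below_support_fun[OF K])
    fix v :: 'a assume "v \<in> sphere 0 1"
    then show "v \<bullet> (inverse ?h *\<^sub>R u) \<le> support_fun K v"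
      using inner_le_support_times_polar[OF K, of v u] h by (simp add: inner_commute field_simps)
  qed
  then have "inverse ?h \<le> ?r"
    using h by (intro radial_fun_is_max(3)[OF Kb(1,3) nu]) auto
  then have ge: "1 \<le> ?r * ?h" using h by (simp add: field_simps)
  obtain v where v: "v \<in> sphere 0 1" "u \<bullet> v = support_fun K v * ?h"
    by (rule inner_eq_support_times_polar[OF K])
  have "v \<bullet> (?r *\<^sub>R u) \<le> support_fun K v"
    by (intro support_fun_is_max(2)[OF Kb(1,4)] radial_fun_is_max(1)[OF Kb(1,3) nu])
  then have "support_fun K v * (?r * ?h) \<le> support_fun K v * 1"
    using v(2) by (simp add: inner_commute mult_ac)
  then have "?r * ?h \<le> 1"
    using support_fun_pos[OF K v(1)] by (simp only: mult_le_cancel_left_pos)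
  with ge show ?thesis by simp
qed

text \<open>
  The right hand side involves only support functions, which are continuous on the whole space;
  the radial function is controlled on the sphere only.
\<close>

lemma outer_normal_iff_polar:
  assumes K: "convex_body_o K" and u: "u \<in> sphere 0 1"
  shows "(radial_fun K u *\<^sub>R u) \<bullet> v = support_fun K v
    \<longleftrightarrow> u \<bullet> v = support_fun K v * support_fun (polar_boundary K) u"
proof -
  let ?r = "radial_fun K u" and ?h = "support_fun (polar_boundary K) u"
  have rh: "?r * ?h = 1" by (rule radial_fun_times_polar_support[OF K u])
  have "?r * a = b \<longleftrightarrow> a = b * ?h" for a b :: real
  proof
    assume b: "?r * a = b"
    have "b * ?h = (?r * ?h) * a" unfolding b[symmetric] by (simp only: mult_ac)
    then show "a = b * ?h" using rh by simp
  next
    assume a: "a = b * ?h"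
    have "?r * a = (?r * ?h) * b" unfolding a by (simp only: mult_ac)
    then show "?r * a = b" using rh by simp
  qed
  then show ?thesis by simp
qed

lemma continuous_on_radial_fun:
  assumes K: "convex_body_o K"
  shows "continuous_on (sphere 0 1) (radial_fun K)"
proof -
  have eq: "radial_fun K u = inverse (support_fun (polar_boundary K) u)"
    and nz: "support_fun (polar_boundary K) u \<noteq> 0" if "u \<in> sphere 0 1" for u
    using radial_fun_times_polar_support[OF K that] by (metis inverse_unique inverse_inverse_eq, auto)
  have "continuous_on (sphere 0 1) (\<lambda>u. inverse (support_fun (polar_boundary K) u))"
    using nz by (intro continuous_intros continuous_on_support_fun compact_polar_boundary K) auto
  then show ?thesis using eq by (metis (no_types, lifting) continuous_on_cong)
qed

text \<open>
  An arbitrary choice among the outer unit normals at the boundary point in direction \<open>u\<close>;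
  almost everywhere there is only one candidate.
\<close>

definition radial_Gauss_map :: "'a::euclidean_space set \<Rightarrow> 'a \<Rightarrow> 'a" where
  "radial_Gauss_map K u = (SOME v. v \<in> sphere 0 1 \<and> (radial_fun K u *\<^sub>R u) \<bullet> v = support_fun K v)"

lemma radial_Gauss_map_is_outer_normal:
  assumes K: "convex_body_o K" and u: "u \<in> sphere 0 1"
  shows "radial_Gauss_map K u \<in> sphere 0 1" "(radial_fun K u *\<^sub>R u) \<bullet> radial_Gauss_map K u = support_fun K (radial_Gauss_map K u)"
proof -
  have "\<exists>v. v \<in> sphere 0 1 \<and> (radial_fun K u *\<^sub>R u) \<bullet> v = support_fun K v"
    using inner_eq_support_times_polar[OF K, of u] outer_normal_iff_polar[OF K u] by metis
  from someI_ex[OF this]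
  show "radial_Gauss_map K u \<in> sphere 0 1" "(radial_fun K u *\<^sub>R u) \<bullet> radial_Gauss_map K u = support_fun K (radial_Gauss_map K u)"
    by (auto simp: radial_Gauss_map_def)
qed

lemma outer_normal_in_exposed_face:
  assumes K: "convex_body_o K" and u: "u \<in> sphere 0 1" and v: "v \<in> sphere 0 1"
    and normal: "(radial_fun K u *\<^sub>R u) \<bullet> v = support_fun K v"
  shows "v /\<^sub>R support_fun K v \<in> exposed_face (polar_boundary K) u"
  using normal v support_fun_pos[OF K v] unfolding outer_normal_iff_polar[OF K u]
  by (auto simp: exposed_face_def polar_boundary_def field_simps)

text \<open>
  Where the maximizer over \<open>polar_boundary K\<close> is unique, so is the outer unit normal, because a
  unit vector \<open>v\<close> is recovered from \<open>v / h\<^sub>K(v)\<close> by normalization. The exceptional null set serves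
  all \<open>E\<close> simultaneously.
\<close>

lemma AE_reverse_Gauss_image_iff:
  fixes K :: "'a::euclidean_space set"
  assumes K: "convex_body_o K"
  shows "AE u in sphere_lebesgue. \<forall>E\<subseteq>sphere 0 1. u \<in> reverse_radial_Gauss_image K E \<longleftrightarrow> radial_Gauss_map K u \<in> E"
  using AE_sphere_unique_maximizer[OF compact_polar_boundary[OF K]] AE_space
proof eventually_elim
  case (elim u)
  then have u: "u \<in> sphere 0 1" by simp
  have unique: "v = radial_Gauss_map K u" if v: "v \<in> sphere 0 1" "(radial_fun K u *\<^sub>R u) \<bullet> v = support_fun K v" for v
  proof -
    note g = radial_Gauss_map_is_outer_normal[OF K u]
    have eq: "v /\<^sub>R support_fun K v = radial_Gauss_map K u /\<^sub>R support_fun K (radial_Gauss_map K u)" (is "_ = ?p")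
      using elim(1) outer_normal_in_exposed_face[OF K u] v g by blast
    have "v = sgn (v /\<^sub>R support_fun K v)"
      using v(1) support_fun_pos[OF K v(1)] by (simp add: sgn_div_norm)
    also have "\<dots> = radial_Gauss_map K u"
      unfolding eq using g(1) support_fun_pos[OF K g(1)] by (simp add: sgn_div_norm)
    finally show ?thesis .
  qed
  show ?case
  proof (intro allI impI iffI)
    fix E :: "'a set" assume E: "E \<subseteq> sphere 0 1" and "u \<in> reverse_radial_Gauss_image K E"
    then obtain v where v: "v \<in> E" "(radial_fun K u *\<^sub>R u) \<bullet> v = support_fun K v"
      by (auto simp only: reverse_radial_Gauss_image_def)
    with E unique show "radial_Gauss_map K u \<in> E" by blast
  next
    fix E :: "'a set" assume "radial_Gauss_map K u \<in> E"
    then show "u \<in> reverse_radial_Gauss_image K E"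
      unfolding reverse_radial_Gauss_image_def using u radial_Gauss_map_is_outer_normal(2)[OF K u] by blast
  qed
qed

text \<open>
  The pairs of a direction and an outer unit normal there form a closed set, by continuity of the
  two support functions; the reverse image is its projection along the compact set of normals in
  \<open>C\<close>.
\<close>

lemma closed_reverse_Gauss_image:
  assumes K: "convex_body_o K" and C: "closed C"
  shows "closed (reverse_radial_Gauss_image K (C \<inter> sphere 0 1))"
proof -
  define T where "T = {(v, u). u \<bullet> v = support_fun K v * support_fun (polar_boundary K) u}"
  have "reverse_radial_Gauss_image K (C \<inter> sphere 0 1)
      = sphere 0 1 \<inter> {u. \<exists>v. v \<in> C \<inter> sphere 0 1 \<and> (v, u) \<in> T}"
    using outer_normal_iff_polar[OF K] by (auto simp: reverse_radial_Gauss_image_def T_def)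
  moreover have "closed {u. \<exists>v. v \<in> C \<inter> sphere 0 1 \<and> (v, u) \<in> T}"
  proof (rule closed_compact_projection)
    show "compact (C \<inter> sphere 0 1)" using C by (intro closed_Int_compact) auto
    have [continuous_intros]: "continuous_on UNIV (\<lambda>z::'a \<times> 'a. support_fun K (fst z))"
      by (intro continuous_on_compose2[OF continuous_on_support_fun[of _ UNIV]] convex_body_oD[OF K] continuous_intros) auto
    have [continuous_intros]: "continuous_on UNIV (\<lambda>z::'a \<times> 'a. support_fun (polar_boundary K) (snd z))"
      by (intro continuous_on_compose2[OF continuous_on_support_fun[of _ UNIV]] compact_polar_boundary[OF K] continuous_intros) auto
    show "closed T"
      unfolding T_def case_prod_unfold by (intro closed_Collect_eq continuous_intros)
  qed
  ultimately show ?thesis by auto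
qed

text \<open>
  The preimage of a closed set under the chosen normal agrees, up to a null set, with the
  reverse Gauss image, which is closed. Completeness of the spherical measure makes the preimage
  measurable, however the choice was made.
\<close>

lemma measurable_radial_Gauss_map:
  fixes K :: "'a::euclidean_space set"
  assumes K: "convex_body_o K"
  shows "radial_Gauss_map K \<in> sphere_lebesgue \<rightarrow>\<^sub>M restrict_space borel (sphere 0 1)"
proof (rule measurable_restrict_space2)
  show "radial_Gauss_map K \<in> space sphere_lebesgue \<rightarrow> sphere 0 1"
    using radial_Gauss_map_is_outer_normal(1)[OF K] by simp
  show "radial_Gauss_map K \<in> borel_measurable sphere_lebesgue"
  proof (rule borel_measurableI)
    fix S :: "'a set" assume S: "open S"
    let ?C = "- S"
    have "reverse_radial_Gauss_image K (?C \<inter> sphere 0 1) \<in> sets sphere_lebesgue" (is "?R \<in> _")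
      using closed_reverse_Gauss_image[OF K, of ?C] S
      by (intro sets_sphere_lebesgue) (auto simp: reverse_radial_Gauss_image_def closed_open)
    then have compl: "space sphere_lebesgue - ?R \<in> sets sphere_lebesgue" by (rule sets.compl_sets)
    have "AE u in sphere_lebesgue. u \<in> space sphere_lebesgue - ?R
        \<longleftrightarrow> u \<in> radial_Gauss_map K -` S \<inter> space sphere_lebesgue"
      using AE_reverse_Gauss_image_iff[OF K] AE_space
    proof eventually_elim
      case (elim u)
      then show ?case using radial_Gauss_map_is_outer_normal(1)[OF K, of u] by auto
    qed
    then show "radial_Gauss_map K -` S \<inter> space sphere_lebesgue \<in> sets sphere_lebesgue"
      using compl unfolding sphere_lebesgue_def by (rule completion.in_sets_AE) auto
  qed
qed

section \<open>Dual curvature measures as image measures\<close>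

definition dual_density :: "real \<Rightarrow> 'a::euclidean_space set \<Rightarrow> 'a set \<Rightarrow> 'a \<Rightarrow> real" where
  "dual_density q K Q u = radial_fun K u powr q * radial_fun Q u powr (real DIM('a) - q)"

lemma dual_density_nonneg [simp]: "0 \<le> dual_density q K Q u"
  by (simp add: dual_density_def)

text \<open>
  The reverse Gauss image of \<open>E\<close> may be replaced by the preimage of \<open>E\<close> under the Gauss map, as they
  differ by a null set. The defining set function is thereby recognized as countably additive,
  and it is the measure of the image of a density.
\<close>

lemma dual_curvature_measure_eq_distr:
  fixes K Q :: "'a::euclidean_space set"
  assumes K: "convex_body_o K"
    and w: "continuous_on (sphere 0 1) (dual_density q K Q)"
  shows "dual_curvature_measure q K Q =
    distr (density sphere_lebesgue (\<lambda>u. ennreal (1 / real DIM('a) * dual_density q K Q u))) (restrict_space borel (sphere 0 1)) (radial_Gauss_map K)"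
    (is "_ = ?D")
proof -
  note [measurable] = measurable_radial_Gauss_map[OF K] borel_measurable_sphere_lebesgue[OF w]
  have sp: "space ?D = sphere 0 1" and st: "sets ?D = sets (restrict_space borel (sphere 0 1))"
    by (simp_all add: space_restrict_space)
  have em: "ennreal (1 / real DIM('a)) * (\<integral>\<^sup>+u\<in>reverse_radial_Gauss_image K E. ennreal (dual_density q K Q u) \<partial>sphere_lebesgue) = emeasure ?D E"
    if E: "E \<in> sets (restrict_space borel (sphere 0 1))" for E
  proof -
    have E': "E \<subseteq> sphere 0 1" using sets.sets_into_space[OF E] by (simp add: space_restrict_space)
    have G: "radial_Gauss_map K -` E \<inter> space sphere_lebesgue \<in> sets sphere_lebesgue"
      using E by (rule measurable_sets[OF measurable_radial_Gauss_map[OF K]])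
    have "emeasure ?D E = emeasure (density sphere_lebesgue (\<lambda>u. ennreal (1 / real DIM('a) * dual_density q K Q u))) (radial_Gauss_map K -` E \<inter> space sphere_lebesgue)"
      using E by (subst emeasure_distr) (auto simp: measurable_radial_Gauss_map[OF K])
    also have "\<dots> = (\<integral>\<^sup>+u. ennreal (1 / real DIM('a) * dual_density q K Q u) * indicator (radial_Gauss_map K -` E \<inter> space sphere_lebesgue) u \<partial>sphere_lebesgue)"
      by (rule emeasure_density[OF _ G]) measurable
    also have "\<dots> = (\<integral>\<^sup>+u. ennreal (1 / real DIM('a)) * (ennreal (dual_density q K Q u) * indicator (radial_Gauss_map K -` E \<inter> space sphere_lebesgue) u) \<partial>sphere_lebesgue)"
      by (intro nn_integral_cong) (simp add: ennreal_mult' mult_ac del: times_divide_eq_left)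
    also have "\<dots> = ennreal (1 / real DIM('a)) * (\<integral>\<^sup>+u. ennreal (dual_density q K Q u) * indicator (radial_Gauss_map K -` E \<inter> space sphere_lebesgue) u \<partial>sphere_lebesgue)"
      by (intro nn_integral_cmult borel_measurable_times_ennreal borel_measurable_indicator G) measurable
    also have "(\<integral>\<^sup>+u. ennreal (dual_density q K Q u) * indicator (radial_Gauss_map K -` E \<inter> space sphere_lebesgue) u \<partial>sphere_lebesgue)
        = (\<integral>\<^sup>+u\<in>reverse_radial_Gauss_image K E. ennreal (dual_density q K Q u) \<partial>sphere_lebesgue)"
    proof (rule nn_integral_cong_AE)
      show "AE u in sphere_lebesgue. ennreal (dual_density q K Q u) * indicator (radial_Gauss_map K -` E \<inter> space sphere_lebesgue) u
          = ennreal (dual_density q K Q u) * indicator (reverse_radial_Gauss_image K E) u"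
        using AE_reverse_Gauss_image_iff[OF K] AE_space
        by eventually_elim (use E' in \<open>auto simp: indicator_def\<close>)
    qed
    finally show ?thesis by simp
  qed
  have "dual_curvature_measure q K Q = measure_of (space ?D) (sets ?D) (emeasure ?D)"
    unfolding dual_curvature_measure_def dual_density_def[symmetric] sp st
  proof (rule measure_of_eq)
    show "sets (restrict_space borel (sphere 0 1 :: 'a set)) \<subseteq> Pow (sphere 0 1)"
      using sets.space_closed[of "restrict_space borel (sphere 0 1 :: 'a set)"] by (simp add: space_restrict_space)
    fix E assume "E \<in> sigma_sets (sphere 0 1) (sets (restrict_space borel (sphere 0 1 :: 'a set)))"
    then have "E \<in> sets (restrict_space borel (sphere 0 1))"
      using sets.sigma_sets_eq[of "restrict_space borel (sphere 0 1 :: 'a set)"] by (simp add: space_restrict_space)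
    then show "ennreal (1 / real DIM('a)) * (\<integral>\<^sup>+u\<in>reverse_radial_Gauss_image K E. ennreal (dual_density q K Q u) \<partial>sphere_lebesgue) = emeasure ?D E"
      by (rule em)
  qed
  then show ?thesis by (simp only: measure_of_of_measure)
qed

lemma lebesgue_integral_dual_curvature_measure:
  fixes K Q :: "'a::euclidean_space set" and f :: "'a \<Rightarrow> real"
  assumes K: "convex_body_o K"
    and w: "continuous_on (sphere 0 1) (dual_density q K Q)"
    and f: "f \<in> borel_measurable (restrict_space borel (sphere 0 1))"
  shows "(LINT v|dual_curvature_measure q K Q. f v)
    = 1 / real DIM('a) * (LINT u|sphere_lebesgue. dual_density q K Q u * f (radial_Gauss_map K u))"
proof -
  note [measurable] = measurable_radial_Gauss_map[OF K] borel_measurable_sphere_lebesgue[OF w] f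
  have "(LINT v|dual_curvature_measure q K Q. f v)
      = (LINT u|density sphere_lebesgue (\<lambda>u. ennreal (1 / real DIM('a) * dual_density q K Q u)). f (radial_Gauss_map K u))"
    unfolding dual_curvature_measure_eq_distr[OF K w] by (rule integral_distr) measurable
  also have "\<dots> = (LINT u|sphere_lebesgue. (1 / real DIM('a) * dual_density q K Q u) *\<^sub>R f (radial_Gauss_map K u))"
    by (rule integral_density) auto
  also have "\<dots> = 1 / real DIM('a) * (LINT u|sphere_lebesgue. dual_density q K Q u * f (radial_Gauss_map K u))"
    by (simp add: mult.assoc)
  finally show ?thesis .
qed

section \<open>Dual mixed volumes, radial and support functions\<close>

lemma dual_mixed_volume_eq:
  fixes K Q :: "'a::euclidean_space set"
  shows "dual_mixed_volume q K Q = 1 / real DIM('a) * (LINT u|sphere_lebesgue. dual_density q K Q u)"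
  by (simp add: dual_mixed_volume_def dual_density_def)

lemma convex_body_radial_fun_pos:
  assumes "convex_body_o K" "u \<in> sphere 0 1"
  shows "0 < radial_fun K u"
  by (rule radial_fun_pos[OF convex_body_oD(1,5)[OF assms(1)] assms(2)])

lemma star_body_radial_fun_pos:
  assumes "star_body_o Q" "u \<in> sphere 0 1"
  shows "0 < radial_fun Q u"
  using assms(1) radial_fun_pos[OF _ _ assms(2), of Q] unfolding star_body_o_def by simp

lemma dual_density_pos:
  assumes "convex_body_o K" "star_body_o Q" "u \<in> sphere 0 1"
  shows "0 < dual_density q K Q u"
  using convex_body_radial_fun_pos[OF assms(1,3)] star_body_radial_fun_pos[OF assms(2,3)]
  by (simp add: dual_density_def)

lemma continuous_on_dual_density:
  fixes K Q :: "'a::euclidean_space set"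
  assumes "convex_body_o K" "star_body_o Q"
  shows "continuous_on (sphere 0 1) (dual_density q K Q)"
proof -
  have "continuous_on (sphere 0 1) (radial_fun Q)" using assms(2) by (simp only: star_body_o_def)
  then have "continuous_on (sphere 0 1) (\<lambda>u. radial_fun K u powr q * radial_fun Q u powr (real DIM('a) - q))"
    using convex_body_radial_fun_pos[OF assms(1), THEN less_imp_neq]
      star_body_radial_fun_pos[OF assms(2), THEN less_imp_neq]
    by (intro continuous_intros continuous_on_radial_fun[OF assms(1)]) auto
  then show ?thesis by (simp only: dual_density_def[abs_def])
qed

lemma dual_mixed_volume_pos:
  fixes K Q :: "'a::euclidean_space set"
  assumes K: "convex_body_o K" and Q: "star_body_o Q"
  shows "0 < dual_mixed_volume q K Q"
proof -
  note cont = continuous_on_dual_density[OF K Q, of q]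
  obtain u :: 'a where u: "u \<in> Basis" using nonempty_Basis by blast
  have "(LINT u|sphere_lebesgue. dual_density q K Q u) \<noteq> 0"
  proof
    assume "(LINT u|sphere_lebesgue. dual_density q K Q u) = 0"
    then have "AE u in sphere_lebesgue. dual_density q K Q u = 0"
      using integral_nonneg_eq_0_iff_AE[OF integrable_sphere_lebesgue[OF cont]] by simp
    then have "dual_density q K Q u = 0"
      by (rule AE_zero_imp_zero_on_sphere[OF cont]) (use u in simp)
    with dual_density_pos[OF K Q, of u q] u show False by simp
  qed
  moreover have "0 \<le> (LINT u|sphere_lebesgue. dual_density q K Q u)"
    by (rule integral_nonneg_AE) simp
  ultimately have "0 < (LINT u|sphere_lebesgue. dual_density q K Q u)" by (rule le_neq_trans[OF _ not_sym, rotated])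
  then show ?thesis by (simp add: dual_mixed_volume_eq)
qed

lemma mem_convex_body_iff_radial_fun:
  assumes K: "convex_body_o K" and x: "x \<noteq> 0"
  shows "x \<in> K \<longleftrightarrow> norm x \<le> radial_fun K (x /\<^sub>R norm x)"
proof
  note Kb = convex_body_oD[OF K]
  have u: "norm (x /\<^sub>R norm x) = 1" using x by simp
  have x_eq: "x = norm x *\<^sub>R (x /\<^sub>R norm x)" using x by simp
  show "norm x \<le> radial_fun K (x /\<^sub>R norm x)" if "x \<in> K"
    using that x_eq by (intro radial_fun_is_max(3)[OF Kb(1,3) u]) auto
  let ?r = "radial_fun K (x /\<^sub>R norm x)"
  assume le: "norm x \<le> ?r"
  have r: "0 < ?r" using le x by (meson less_le_trans zero_less_norm_iff)
  have "(norm x / ?r) *\<^sub>R (?r *\<^sub>R (x /\<^sub>R norm x)) + (1 - norm x / ?r) *\<^sub>R 0 \<in> K"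
    using le r by (intro convexD[OF Kb(2) radial_fun_is_max(1)[OF Kb(1,3) u] Kb(3)]) auto
  also have "(norm x / ?r) *\<^sub>R (?r *\<^sub>R (x /\<^sub>R norm x)) + (1 - norm x / ?r) *\<^sub>R 0 = x"
    using r x by simp
  finally show "x \<in> K" .
qed

lemma dilates_if_radial_fun_proportional:
  assumes K: "convex_body_o K" and L: "convex_body_o L" and c: "0 < c"
    and rho: "\<And>u. u \<in> sphere 0 1 \<Longrightarrow> radial_fun L u = c * radial_fun K u"
  shows "dilates K L"
proof -
  have iff: "x \<in> K \<longleftrightarrow> c *\<^sub>R x \<in> L" for x
  proof (cases "x = 0")
    case True
    then show ?thesis using convex_body_oD(3)[OF K] convex_body_oD(3)[OF L] by simp
  next
    case False
    then have "x /\<^sub>R norm x \<in> sphere 0 1" by simp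
    note rho_x = rho[OF this]
    have dir: "(c *\<^sub>R x) /\<^sub>R norm (c *\<^sub>R x) = x /\<^sub>R norm x" using c by (simp add: mult.commute)
    have "c *\<^sub>R x \<in> L \<longleftrightarrow> c * norm x \<le> c * radial_fun K (x /\<^sub>R norm x)"
      using mem_convex_body_iff_radial_fun[OF L, of "c *\<^sub>R x"] False c unfolding dir rho_x by simp
    then show ?thesis
      using mem_convex_body_iff_radial_fun[OF K False] c by simp
  qed
  have "K = (\<lambda>x. inverse c *\<^sub>R x) ` L"
  proof (intro set_eqI iffI)
    fix x assume "x \<in> K"
    then have "c *\<^sub>R x \<in> L" by (simp add: iff)
    then show "x \<in> (\<lambda>x. inverse c *\<^sub>R x) ` L"
      using c by (intro image_eqI[of _ _ "c *\<^sub>R x"]) auto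
  qed (use c in \<open>auto simp: iff\<close>)
  then show ?thesis unfolding dilates_def using c by (intro exI[of _ "inverse c"]) auto
qed

lemma support_fun_scaled:
  assumes L: "convex_body_o L" and c: "0 < c"
  shows "support_fun ((\<lambda>x. c *\<^sub>R x) ` L) v = c * support_fun L v"
proof -
  let ?K = "(\<lambda>x. c *\<^sub>R x) ` L"
  note Lb = convex_body_oD[OF L]
  have K: "compact ?K" "?K \<noteq> {}" using Lb by (auto intro: compact_scaling)
  show ?thesis
  proof (rule antisym)
    obtain x where "x \<in> L" "support_fun ?K v = v \<bullet> (c *\<^sub>R x)"
      using support_fun_is_max(1)[OF K, of v] by auto
    then show "support_fun ?K v \<le> c * support_fun L v"
      using support_fun_is_max(2)[OF Lb(1,4), of x v] c by simp
    obtain y where y: "y \<in> L" "support_fun L v = v \<bullet> y"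
      using support_fun_is_max(1)[OF Lb(1,4)] by blast
    then have "v \<bullet> (c *\<^sub>R y) \<le> support_fun ?K v"
      by (intro support_fun_is_max(2)[OF K]) auto
    then show "c * support_fun L v \<le> support_fun ?K v" using y by simp
  qed
qed

lemma radial_fun_scaled:
  assumes L: "convex_body_o L" and c: "0 < c" and u: "u \<in> sphere 0 1"
  shows "radial_fun ((\<lambda>x. c *\<^sub>R x) ` L) u = c * radial_fun L u"
proof -
  let ?K = "(\<lambda>x. c *\<^sub>R x) ` L"
  note Lb = convex_body_oD[OF L]
  have nu: "norm u = 1" using u by simp
  have K: "compact ?K" "0 \<in> ?K" using Lb by (auto intro: compact_scaling image_eqI[of _ _ 0])
  show ?thesis
  proof (rule antisym)
    obtain x where x: "x \<in> L" "radial_fun ?K u *\<^sub>R u = c *\<^sub>R x"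
      using radial_fun_is_max(1)[OF K nu] by auto
    then have "(radial_fun ?K u / c) *\<^sub>R u = x"
      using c by (simp add: divide_inverse_commute flip: scaleR_scaleR) simp
    then have "radial_fun ?K u / c \<le> radial_fun L u"
      using x(1) radial_fun_is_max(2)[OF K nu] c by (intro radial_fun_is_max(3)[OF Lb(1,3) nu]) auto
    then show "radial_fun ?K u \<le> c * radial_fun L u" using c by (simp add: field_simps)
    have "c *\<^sub>R (radial_fun L u *\<^sub>R u) \<in> ?K"
      by (intro imageI radial_fun_is_max(1)[OF Lb(1,3) nu])
    then show "c * radial_fun L u \<le> radial_fun ?K u"
      using radial_fun_is_max(2)[OF Lb(1,3) nu] c by (intro radial_fun_is_max(3)[OF K nu]) auto
  qed
qed

text \<open>
  With \<open>v\<close> the normal at \<open>\<rho>\<^sub>K(u) u\<close> one has \<open>h\<^sub>K(v) = \<rho>\<^sub>K(u) u \<bullet> v\<close>, and \<open>\<rho>\<^sub>L(u) u \<bullet> v \<le> h\<^sub>L(v)\<close> since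
  \<open>\<rho>\<^sub>L(u) u\<close> is a point of \<open>L\<close>.
\<close>

lemma radial_ratio_le_support_ratio:
  assumes K: "convex_body_o K" and L: "convex_body_o L" and u: "u \<in> sphere 0 1"
  shows "radial_fun L u / radial_fun K u \<le> support_fun L (radial_Gauss_map K u) / support_fun K (radial_Gauss_map K u)"
proof -
  note g = radial_Gauss_map_is_outer_normal[OF K u] and Lb = convex_body_oD[OF L]
  have nu: "norm u = 1" using u by simp
  let ?v = "radial_Gauss_map K u"
  have r: "0 < radial_fun K u" by (rule convex_body_radial_fun_pos[OF K u])
  have h: "0 < support_fun K ?v" by (rule support_fun_pos[OF K g(1)])
  have eq: "support_fun K ?v = radial_fun K u * (u \<bullet> ?v)" using g(2) by simp
  have "radial_fun L u * (u \<bullet> ?v) \<le> support_fun L ?v"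
    using support_fun_is_max(2)[OF Lb(1,4) radial_fun_is_max(1)[OF Lb(1,3) nu], of ?v]
    by (simp add: inner_commute)
  then show ?thesis
    using r h unfolding eq by (simp add: zero_less_mult_iff field_simps)
qed

lemma continuous_on_ln_support_ratio:
  assumes K: "convex_body_o K" and L: "convex_body_o L"
  shows "continuous_on (sphere 0 1) (\<lambda>v. ln (support_fun L v / support_fun K v))"
  using support_fun_pos[OF K] support_fun_pos[OF L] convex_body_oD[OF K] convex_body_oD[OF L]
  by (intro continuous_intros continuous_on_support_fun) force+

section \<open>The inequality and its equality case\<close>

text \<open>
  Jensen's inequality for the logarithm is used in the form \<open>ln s \<le> s - 1\<close>, applied to
  \<open>s = w\<^sub>L / (a w\<^sub>K)\<close>, where \<open>a\<close> is the ratio of the dual mixed volumes. The factor \<open>a\<close> is chosen so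
  that \<open>w\<^sub>K s\<close> and \<open>w\<^sub>K\<close> have the same integral, hence the linear part \<open>s - 1\<close> contributes nothing.
  The deficit \<open>J = w\<^sub>K (s - 1 - ln s)\<close> is continuous and nonnegative; in case of equality its
  integral vanishes, so \<open>J\<close> vanishes identically and \<open>s = 1\<close> everywhere.
\<close>

lemma dual_log_Minkowski:
  fixes K L Q :: "'a::euclidean_space set"
  assumes Q: "star_body_o Q" and q: "q < 0" and K: "convex_body_o K" and L: "convex_body_o L"
  defines "a \<equiv> dual_mixed_volume q L Q / dual_mixed_volume q K Q"
    and "I \<equiv> (LINT v|dual_curvature_measure q K Q. ln (support_fun L v / support_fun K v))"
  shows "q * I \<le> dual_mixed_volume q K Q * ln a"
    and "q * I = dual_mixed_volume q K Q * ln a \<Longrightarrow> dilates K L"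
proof -
  interpret finite_measure "sphere_lebesgue :: 'a measure" by (rule finite_measure_sphere_lebesgue)
  define n where "n = real DIM('a)"
  have n: "0 < n" by (simp add: n_def)
  define f where "f v = ln (support_fun L v / support_fun K v)" for v
  define wK where "wK = dual_density q K Q"
  define wL where "wL = dual_density q L Q"
  define F where "F u = f (radial_Gauss_map K u)" for u
  note wK_pos = dual_density_pos[OF K Q, of _ q, folded wK_def]
  note wL_pos = dual_density_pos[OF L Q, of _ q, folded wL_def]
  have contK: "continuous_on (sphere 0 1) wK" and contL: "continuous_on (sphere 0 1) wL"
    using continuous_on_dual_density K L Q by (auto simp: wK_def wL_def)
  have contf: "continuous_on (sphere 0 1) f"
    unfolding f_def by (rule continuous_on_ln_support_ratio[OF K L])
  have VK: "(LINT u|sphere_lebesgue. wK u) = n * dual_mixed_volume q K Q"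
    and VL: "(LINT u|sphere_lebesgue. wL u) = n * dual_mixed_volume q L Q"
    by (auto simp: wK_def wL_def dual_mixed_volume_eq n_def)
  note posK = dual_mixed_volume_pos[OF K Q, of q] and posL = dual_mixed_volume_pos[OF L Q, of q]
  have a: "0 < a" using posK posL by (simp add: a_def)
  have f_meas: "f \<in> borel_measurable (restrict_space borel (sphere 0 1))"
    by (rule borel_measurable_continuous_on_restrict[OF contf])
  have I_eq: "(LINT u|sphere_lebesgue. wK u * F u) = n * I"
    using lebesgue_integral_dual_curvature_measure[OF K continuous_on_dual_density[OF K Q] f_meas]
    by (simp add: I_def f_def[symmetric] F_def wK_def n_def)
  have intK: "integrable sphere_lebesgue wK" and intL: "integrable sphere_lebesgue wL"
    using contK contL by (auto intro: integrable_sphere_lebesgue)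
  have intKF: "integrable sphere_lebesgue (\<lambda>u. wK u * F u)"
  proof -
    have "compact (f ` sphere 0 1)" using contf by (intro compact_continuous_image) auto
    then obtain B where B: "\<And>v. v \<in> sphere 0 1 \<Longrightarrow> \<bar>f v\<bar> \<le> B"
      using compact_imp_bounded bounded_iff by (metis imageI real_norm_def)
    have [measurable]: "wK \<in> borel_measurable sphere_lebesgue" "F \<in> borel_measurable sphere_lebesgue"
      using borel_measurable_sphere_lebesgue[OF contK] measurable_compose[OF measurable_radial_Gauss_map[OF K] f_meas]
      by (auto simp: F_def[abs_def])
    show ?thesis
    proof (rule Bochner_Integration.integrable_bound)
      show "integrable sphere_lebesgue (\<lambda>u. B * wK u)" using intK by simp
      show "AE u in sphere_lebesgue. norm (wK u * F u) \<le> norm (B * wK u)"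
      proof (rule AE_I2)
        fix u :: 'a assume "u \<in> space sphere_lebesgue"
        then have u: "u \<in> sphere 0 1" by simp
        have "\<bar>F u\<bar> \<le> B" using B radial_Gauss_map_is_outer_normal(1)[OF K u] by (simp add: F_def)
        then have "\<bar>wK u\<bar> * \<bar>F u\<bar> \<le> \<bar>wK u\<bar> * \<bar>B\<bar>" by (intro mult_left_mono) auto
        then show "norm (wK u * F u) \<le> norm (B * wK u)" by (simp add: abs_mult mult.commute)
      qed
    qed measurable
  qed
  \<comment> \<open>The integral of \<open>D\<close> is the gap in the asserted inequality, up to the factor \<open>n\<close>;
    the bracket integrates to zero.\<close>
  define D where "D u = ln a * wK u - q * (wK u * F u) + (wL u / a - wK u)" for u
  have intD: "integrable sphere_lebesgue D"
    unfolding D_def using intK intL intKF by auto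
  have "(LINT u|sphere_lebesgue. D u) = ln a * (n * dual_mixed_volume q K Q) - q * (n * I)
      + (n * dual_mixed_volume q L Q / a - n * dual_mixed_volume q K Q)"
    unfolding D_def using intK intL intKF by (simp add: VK VL I_eq)
  also have "n * dual_mixed_volume q L Q / a = n * dual_mixed_volume q K Q"
    using posK posL by (simp add: a_def)
  finally have D_eq: "(LINT u|sphere_lebesgue. D u) = n * (dual_mixed_volume q K Q * ln a - q * I)"
    by (simp add: algebra_simps)
  define s where "s u = wL u / wK u / a" for u
  define J where "J u = wK u * (s u - 1 - ln (s u))" for u
  have s_pos: "0 < s u" if "u \<in> sphere 0 1" for u
    using wK_pos[OF that] wL_pos[OF that] a by (simp add: s_def)
  have J_nonneg: "0 \<le> J u" if u: "u \<in> sphere 0 1" for u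
    using wK_pos[OF u] ln_le_minus_one[OF s_pos[OF u]] by (simp add: J_def)
  have ratio: "wL u / wK u = (radial_fun L u / radial_fun K u) powr q" if u: "u \<in> sphere 0 1" for u
    using convex_body_radial_fun_pos[OF K u] convex_body_radial_fun_pos[OF L u] star_body_radial_fun_pos[OF Q u]
    by (simp add: wK_def wL_def dual_density_def powr_divide)
  have J_le_D: "J u \<le> D u" if u: "u \<in> sphere 0 1" for u
  proof -
    note rK = convex_body_radial_fun_pos[OF K u] and rL = convex_body_radial_fun_pos[OF L u]
    have "ln (radial_fun L u / radial_fun K u) \<le> F u"
      unfolding F_def f_def using radial_ratio_le_support_ratio[OF K L u] rK rL
      by (intro ln_mono) auto
    then have "q * F u \<le> q * ln (radial_fun L u / radial_fun K u)"
      using q by (intro mult_left_mono_neg) auto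
    also have "\<dots> = ln (wL u / wK u)" using rK rL unfolding ratio[OF u] by (simp add: ln_powr)
    also have "\<dots> = ln (s u) + ln a"
    proof -
      have "wL u / wK u = s u * a" using a by (simp add: s_def)
      then show ?thesis using ln_mult_pos[OF s_pos[OF u] a] by simp
    qed
    finally have "wK u * (q * F u) \<le> wK u * (ln (s u) + ln a)"
      using wK_pos[OF u] by (intro mult_left_mono) auto
    moreover have "wL u / a = wK u * s u"
      using wK_pos[OF u] by (simp add: s_def)
    ultimately show ?thesis by (simp add: J_def D_def algebra_simps)
  qed
  have contJ: "continuous_on (sphere 0 1) J"
    unfolding J_def s_def using wK_pos wL_pos a
    by (intro continuous_intros contK contL) force+
  have intJ: "integrable sphere_lebesgue J" by (rule integrable_sphere_lebesgue[OF contJ])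
  have J_AE_nonneg: "AE u in sphere_lebesgue. 0 \<le> J u"
    using J_nonneg by (intro AE_I2) simp
  then have J_int_nonneg: "0 \<le> (LINT u|sphere_lebesgue. J u)"
    by (rule integral_nonneg_AE)
  have J_int_le: "(LINT u|sphere_lebesgue. J u) \<le> n * (dual_mixed_volume q K Q * ln a - q * I)"
    unfolding D_eq[symmetric] using J_le_D by (intro integral_mono intJ intD) simp
  have "0 \<le> n * (dual_mixed_volume q K Q * ln a - q * I)"
    using J_int_nonneg J_int_le by (rule order_trans)
  then show "q * I \<le> dual_mixed_volume q K Q * ln a"
    using n by (simp add: zero_le_mult_iff)
  assume eq: "q * I = dual_mixed_volume q K Q * ln a"
  have "(LINT u|sphere_lebesgue. J u) = 0"
    using J_int_le J_int_nonneg eq by simp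
  then have ae: "AE u in sphere_lebesgue. J u = 0"
    using integral_nonneg_eq_0_iff_AE[OF intJ J_AE_nonneg] by blast
  show "dilates K L"
  proof (rule dilates_if_radial_fun_proportional[OF K L])
    show "0 < a powr (1 / q)" using a by simp
    fix u :: 'a assume u: "u \<in> sphere 0 1"
    note rK = convex_body_radial_fun_pos[OF K u] and rL = convex_body_radial_fun_pos[OF L u]
    have "J u = 0" by (rule AE_zero_imp_zero_on_sphere[OF contJ ae u])
    then have "ln (s u) = s u - 1" using wK_pos[OF u] by (simp add: J_def)
    then have "s u = 1" using ln_eq_minus_one s_pos[OF u] by blast
    then have "(radial_fun L u / radial_fun K u) powr q = a"
      using a ratio[OF u] by (simp add: s_def)
    then have "a powr (1 / q) = radial_fun L u / radial_fun K u"
      using q rK rL by (auto simp: powr_powr)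
    then show "radial_fun L u = a powr (1 / q) * radial_fun K u" using rK by simp
  qed
qed

text \<open>
  For \<open>K = c L\<close> the integrand is the constant \<open>- log c\<close>, the dual curvature measure has total mass
  \<open>V\<^sub>q(K,Q)\<close>, and \<open>V\<^sub>q\<close> is homogeneous of degree \<open>q\<close>.
\<close>

lemma dual_log_Minkowski_eq_if_dilates:
  fixes K L Q :: "'a::euclidean_space set"
  assumes Q: "star_body_o Q" and K: "convex_body_o K" and L: "convex_body_o L"
    and dil: "dilates K L"
  shows "q * (LINT v|dual_curvature_measure q K Q. ln (support_fun L v / support_fun K v))
    = dual_mixed_volume q K Q * ln (dual_mixed_volume q L Q / dual_mixed_volume q K Q)"
proof -
  obtain c where c: "0 < c" "K = (\<lambda>x. c *\<^sub>R x) ` L" using dil by (auto simp: dilates_def)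
  note pos = dual_mixed_volume_pos[OF K Q, of q] dual_mixed_volume_pos[OF L Q, of q]
  have f_meas: "(\<lambda>v. ln (support_fun L v / support_fun K v)) \<in> borel_measurable (restrict_space borel (sphere 0 1))"
    by (rule borel_measurable_continuous_on_restrict[OF continuous_on_ln_support_ratio[OF K L]])
  have "(LINT v|dual_curvature_measure q K Q. ln (support_fun L v / support_fun K v))
     = 1 / real DIM('a) * (LINT u|sphere_lebesgue. dual_density q K Q u * (- ln c))"
  proof (subst lebesgue_integral_dual_curvature_measure[OF K continuous_on_dual_density[OF K Q] f_meas],
      intro arg_cong2[where f = "(*)"] refl Bochner_Integration.integral_cong)
    fix u :: 'a assume "u \<in> space sphere_lebesgue"
    then have g: "radial_Gauss_map K u \<in> sphere 0 1" using radial_Gauss_map_is_outer_normal(1)[OF K, of u] by simp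
    have "support_fun L (radial_Gauss_map K u) / support_fun K (radial_Gauss_map K u) = inverse c"
      using support_fun_scaled[OF L c(1), folded c(2), of "radial_Gauss_map K u"] support_fun_pos[OF L g] c(1)
      by (simp add: field_simps)
    then show "ln (support_fun L (radial_Gauss_map K u) / support_fun K (radial_Gauss_map K u)) = - ln c"
      using c(1) by (simp add: ln_inverse)
  qed
  also have "\<dots> = - ln c * dual_mixed_volume q K Q"
    by (simp add: dual_mixed_volume_eq)
  finally have lhs: "(LINT v|dual_curvature_measure q K Q. ln (support_fun L v / support_fun K v))
     = - ln c * dual_mixed_volume q K Q" .
  have "(LINT u|sphere_lebesgue. dual_density q K Q u) = (LINT u|sphere_lebesgue. c powr q * dual_density q L Q u)"
  proof (intro Bochner_Integration.integral_cong refl)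
    fix u :: 'a assume "u \<in> space sphere_lebesgue"
    then have u: "u \<in> sphere 0 1" by simp
    show "dual_density q K Q u = c powr q * dual_density q L Q u"
      using radial_fun_scaled[OF L c(1) u, folded c(2)] convex_body_radial_fun_pos[OF L u] c(1)
      by (simp add: dual_density_def powr_mult)
  qed
  then have "dual_mixed_volume q K Q = c powr q * dual_mixed_volume q L Q"
    by (simp add: dual_mixed_volume_eq)
  then have "dual_mixed_volume q L Q / dual_mixed_volume q K Q = c powr (- q)"
    using pos c(1) by (simp add: powr_minus field_simps)
  then show ?thesis using lhs c(1) by (simp add: ln_powr)
qed

theorem theorem3p3:
  fixes K L Q :: "(real ^ 'n) set" and q :: real
  assumes "star_body_o Q" and "q < 0" and "convex_body_o K" and "convex_body_o L"
  shows "1 / dual_mixed_volume q K Q *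
           (LINT v|dual_curvature_measure q K Q. ln (support_fun L v / support_fun K v))
         \<ge> 1 / q * ln (dual_mixed_volume q L Q / dual_mixed_volume q K Q)
    \<and> (1 / dual_mixed_volume q K Q *
           (LINT v|dual_curvature_measure q K Q. ln (support_fun L v / support_fun K v))
         = 1 / q * ln (dual_mixed_volume q L Q / dual_mixed_volume q K Q)
       \<longleftrightarrow> dilates K L)"
proof -
  define V where "V = dual_mixed_volume q K Q"
  define I where "I = (LINT v|dual_curvature_measure q K Q. ln (support_fun L v / support_fun K v))"
  define l where "l = ln (dual_mixed_volume q L Q / V)"
  have V: "0 < V" unfolding V_def by (rule dual_mixed_volume_pos[OF assms(3,1)])
  have le: "q * I \<le> V * l" and eq: "q * I = V * l \<longleftrightarrow> dilates K L"
    unfolding I_def V_def l_def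
    using dual_log_Minkowski[OF assms] dual_log_Minkowski_eq_if_dilates[OF assms(1,3,4)] by blast+
  \<comment> \<open>Since \<open>q < 0 < V\<close>, clearing denominators reverses the inequality.\<close>
  have "1 / q * l \<le> 1 / V * I \<longleftrightarrow> q * I \<le> V * l" "1 / V * I = 1 / q * l \<longleftrightarrow> q * I = V * l"
    using V assms(2) by (auto simp: field_simps)
  then show ?thesis
    using le eq by (simp add: I_def V_def l_def)
qed

end
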